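(* Let $G$ be a finite group with $|G|>2$. Then $G$ is a $CD1$-group if and only if there exists $\chi\in\mathrm{Irr}(G)$ such that $\bigcap_{\psi\in\mathrm{Irr}(G)\setminus\{\chi\}}\ker\psi\ne\{1\}$.
   Context: $\mathrm{Irr}(G)$ is the set of complex irreducible characters of $G$. A finite group $G$ is a $CD1$-group if $|G|>2$ and two columns of its complex character table differ by exactly one entry, i.e. there are non-conjugate $a,b\in G$ and a $\chi\in\mathrm{Irr}(G)$ with $\chi(a)\ne\chi(b)$ and $\psi(a)=\psi(b)$ for all $\psi\in\mathrm{Irr}(G)\setminus\{\chi\}$. *)

theory Defs
  imports "Jordan_Normal_Form.VS_Connect"
begin

definition GL :: "nat \<Rightarrow> complex mat monoid" where
  "GL n = units_of (ring_mat TYPE(complex) n ())"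

definition mat_trace :: "complex mat \<Rightarrow> complex" where
  "mat_trace A = (\<Sum>i<dim_row A. A $$ (i, i))"

definition matrix_rep :: "('a, 'b) monoid_scheme \<Rightarrow> nat \<Rightarrow> ('a \<Rightarrow> complex mat) \<Rightarrow> bool" where
  "matrix_rep G n \<rho> \<longleftrightarrow> \<rho> \<in> hom G (GL n)"

definition irreducible_rep :: "('a, 'b) monoid_scheme \<Rightarrow> nat \<Rightarrow> ('a \<Rightarrow> complex mat) \<Rightarrow> bool" where
  "irreducible_rep G n \<rho> \<longleftrightarrow> matrix_rep G n \<rho> \<and> n > 0 \<and>
     (\<forall>W. VectorSpace.subspace class_ring W (module_vec TYPE(complex) n) \<and>
          (\<forall>g\<in>carrier G. \<forall>w\<in>W. \<rho> g *\<^sub>v w \<in> W)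
        \<longrightarrow> W = {0\<^sub>v n} \<or> W = carrier_vec n)"

text \<open>Characters are restricted to the carrier (and so undefined outside it); this makes two
  characters equal as HOL functions exactly when they agree on the group, which the set
  difference \<open>Irr G - {\<chi>}\<close> relies on.\<close>

definition character_of :: "('a, 'b) monoid_scheme \<Rightarrow> ('a \<Rightarrow> complex mat) \<Rightarrow> 'a \<Rightarrow> complex" where
  "character_of G \<rho> = (\<lambda>g\<in>carrier G. mat_trace (\<rho> g))"

definition Irr :: "('a, 'b) monoid_scheme \<Rightarrow> ('a \<Rightarrow> complex) set" where
  "Irr G = {character_of G \<rho> | \<rho> n. irreducible_rep G n \<rho>}"

definition char_kernel :: "('a, 'b) monoid_scheme \<Rightarrow> ('a \<Rightarrow> complex) \<Rightarrow> 'a set" where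
  "char_kernel G \<chi> = {g \<in> carrier G. \<chi> g = \<chi> \<one>\<^bsub>G\<^esub>}"

definition conjugate_in :: "('a, 'b) monoid_scheme \<Rightarrow> 'a \<Rightarrow> 'a \<Rightarrow> bool" where
  "conjugate_in G a b \<longleftrightarrow> (\<exists>g\<in>carrier G. b = g \<otimes>\<^bsub>G\<^esub> a \<otimes>\<^bsub>G\<^esub> inv\<^bsub>G\<^esub> g)"

definition CD1_group :: "('a, 'b) monoid_scheme \<Rightarrow> bool" where
  "CD1_group G \<longleftrightarrow> group G \<and> finite (carrier G) \<and> Coset.order G > 2 \<and>
     (\<exists>a\<in>carrier G. \<exists>b\<in>carrier G. \<not> conjugate_in G a b \<and>
       (\<exists>\<chi>\<in>Irr G. \<chi> a \<noteq> \<chi> b \<and> (\<forall>\<psi>\<in>Irr G - {\<chi>}. \<psi> a = \<psi> b)))"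

end

theory Submission
  imports Defs "Jordan_Normal_Form.DL_Rank"
begin

text \<open>
  Everything rests on one property of the regular character, which takes the value \<open>|G|\<close> at the
  identity and 0 elsewhere: it is a finite sum of irreducible characters in which any prescribed
  irreducible character occurs.

  Suppose the columns of \<open>a\<close> and \<open>b\<close> differ only in the entry of \<open>\<chi>\<close>. Then the difference of the
  regular character at \<open>a\<close> and \<open>b\<close> is \<open>m * (\<chi> a - \<chi> b)\<close>, where \<open>m > 0\<close> counts the occurrences
  of \<open>\<chi>\<close>, hence it is nonzero. So one of \<open>a\<close>, \<open>b\<close> is the identity, and as they are not
  conjugate, the other one is a nontrivial element of the kernel of every
  \<open>\<psi> \<noteq> \<chi>\<close>. Conversely, let \<open>x \<noteq> 1\<close> lie in all these kernels. The regular character separates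
  \<open>x\<close> from 1, so some irreducible character does, and that can only be \<open>\<chi>\<close>: the columns of \<open>x\<close>
  and 1 differ in exactly one entry, and \<open>x\<close> is not conjugate to 1.

  The decomposition of the regular character comes from the additivity of traces: an invariant
  subspace makes the representing matrices block triangular in a suitable basis, and the trace is
  the sum of the traces of the diagonal blocks. Induction on the degree then writes the
  trace of any representation as a sum of irreducible characters
  (\<open>character_as_sum_of_irr\<close>). An irreducible representation embeds into the regular one through
  its matrix coefficients (\<open>irreducible_in_regular\<close>), so its character is the
  trace of one of two diagonal blocks there and may be taken as the first summand
  (\<open>irr_constituent_of_regular\<close>).
\<close>

section \<open>Matrices adapted to a subspace\<close>

lemma mat_mult_assoc_dim:
  fixes A B C :: "complex mat"
  assumes "dim_col A = dim_row B" "dim_col B = dim_row C"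
  shows "A * B * C = A * (B * C)"
  by (rule assoc_mult_mat[of A "dim_row A" "dim_row B" B "dim_row C" C "dim_col C"])
     (use assms in auto)

text \<open>
  A basis of \<open>W\<close>, completed to a basis of the whole space, gives an invertible matrix \<open>[K S]\<close> whose
  inverse has the blocks \<open>L\<close> and \<open>F\<close>. So \<open>K\<close> and \<open>L\<close> translate between \<open>W\<close> and its coordinates,
  \<open>F\<close> and \<open>S\<close> do the same for the quotient by \<open>W\<close>. Stating the block identities
  \<open>L K = 1\<close>, \<open>F S = 1\<close>, \<open>F K = 0\<close>, \<open>K L + S F = 1\<close> instead of a change of basis keeps later
  computations free of block decompositions.
\<close>

lemma subspace_frame:
  assumes W: "VectorSpace.subspace class_ring W (module_vec TYPE(complex) n)"
  obtains k K L S F where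
    "k \<le> n" "K \<in> carrier_mat n k" "L \<in> carrier_mat k n"
    "S \<in> carrier_mat n (n - k)" "F \<in> carrier_mat (n - k) n"
    "L * K = 1\<^sub>m k" "F * S = 1\<^sub>m (n - k)" "F * K = 0\<^sub>m (n - k) k"
    "K * L + S * F = 1\<^sub>m n"
    "W = {w \<in> carrier_vec n. F *\<^sub>v w = 0\<^sub>v (n - k)}"
    "\<And>w. w \<in> W \<longleftrightarrow> (\<exists>x\<in>carrier_vec k. w = K *\<^sub>v x)"
proof -
  interpret vec_space "TYPE(complex)" n .
  have sub: "submodule class_ring W V" using W by (simp add: subspace_def)
  have WV: "W \<subseteq> carrier_vec n" using sub by (auto simp: submodule_def module_vec_simps)
  have bound: "finite T \<and> card T \<le> n" if "T \<subseteq> carrier_vec n" "lin_indpt T" for T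
    using li_le_dim[OF fin_dim _ that(2)] that(1) by (simp add: dim_is_n)
  have li0: "lin_indpt {}"
    using unit_vecs_basis subset_li_is_li[of "set (unit_vecs n)" "{}"] by (auto simp: basis_def)
  \<comment> \<open>A maximal independent subset of \<open>W\<close> spans \<open>W\<close>; a maximal independent set above it is a basis
    of the whole space.\<close>
  have "\<exists>A. finite A \<and> maximal A (\<lambda>T. T \<subseteq> W \<and> lin_indpt T)"
  proof (rule maximal_exists[where N = n and B = "{}"])
    show "finite T \<and> card T \<le> n" if "T \<subseteq> W \<and> lin_indpt T" for T
      using bound[of T] that WV by blast
    show "{} \<subseteq> W \<and> lin_indpt {}" using li0 by blast
  qed
  then obtain A where Afin: "finite A" and Amaximal: "maximal A (\<lambda>T. T \<subseteq> W \<and> lin_indpt T)"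
    by (elim exE conjE)
  have A: "finite A" "A \<subseteq> W" "lin_indpt A"
    and Amax: "\<And>T. A \<subseteq> T \<Longrightarrow> T \<subseteq> W \<Longrightarrow> lin_indpt T \<Longrightarrow> T = A"
    using Afin Amaximal unfolding maximal_def by simp_all
  have spanA: "span A = W"
  proof
    show "span A \<subseteq> W" by (rule span_is_subset[OF A(2) sub])
    show "W \<subseteq> span A"
    proof
      fix w assume w: "w \<in> W"
      show "w \<in> span A"
      proof (rule ccontr)
        assume nw: "w \<notin> span A"
        have AV: "A \<subseteq> carrier_vec n" using A(2) WV by auto
        have wA: "w \<notin> A" using nw in_own_span[OF AV] by auto
        have "lin_indpt (A \<union> {w})"
          using lin_dep_iff_in_span[OF AV A(3) _ wA] w WV nw by (auto simp: module_vec_simps)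
        then have "A \<union> {w} = A" using Amax[of "A \<union> {w}"] w A(2) by auto
        then show False using wA by auto
      qed
    qed
  qed
  have "\<exists>B. finite B \<and> maximal B (\<lambda>T. A \<subseteq> T \<and> T \<subseteq> carrier_vec n \<and> lin_indpt T)"
  proof (rule maximal_exists[where N = n and B = A])
    show "finite T \<and> card T \<le> n" if "A \<subseteq> T \<and> T \<subseteq> carrier_vec n \<and> lin_indpt T" for T
      using bound[of T] that by blast
    show "A \<subseteq> A \<and> A \<subseteq> carrier_vec n \<and> lin_indpt A" using A WV by blast
  qed
  then obtain B where Bfin: "finite B"
    and Bmaximal: "maximal B (\<lambda>T. A \<subseteq> T \<and> T \<subseteq> carrier_vec n \<and> lin_indpt T)"
    by (elim exE conjE)
  have B: "finite B" "A \<subseteq> B" "B \<subseteq> carrier_vec n" "lin_indpt B"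
    using Bfin Bmaximal unfolding maximal_def by simp_all
  have Bmax: "maximal B (\<lambda>T. T \<subseteq> carrier_vec n \<and> lin_indpt T)"
    using Bmaximal order_trans[OF B(2)] unfolding maximal_def by simp
  have cardB: "card B = n"
    using dim_basis[OF B(1) max_li_is_basis[OF Bmax]] dim_is_n by simp
  obtain as where as: "set as = A" "distinct as" using finite_distinct_list[OF A(1)] by auto
  obtain bs where bs: "set bs = B - A" "distinct bs"
    using finite_distinct_list[of "B - A"] B(1) by auto
  define k where "k = length as"
  have len: "length (as @ bs) = n"
    using cardB as bs B(2) distinct_card[of "as @ bs"] by (auto simp: Un_absorb1)
  then have kn: "k \<le> n" by (simp add: k_def)
  define P where "P = mat_of_cols n (as @ bs)"
  have P: "P \<in> carrier_mat n n" using len by (auto simp: P_def)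
  have colsP: "cols P = as @ bs" unfolding P_def
    by (rule cols_mat_of_cols) (use as bs B in auto)
  have "rank P = n"
    by (rule lin_indpt_full_rank[OF P]) (use colsP as bs B in \<open>auto simp: Un_absorb1\<close>)
  then have "det P \<noteq> 0" using det_rank_iff[OF P] by simp
  from det_non_zero_imp_unit[OF P this, of "()"] obtain Q where
    Q: "Q \<in> carrier_mat n n" "Q * P = 1\<^sub>m n" "P * Q = 1\<^sub>m n"
    unfolding Units_def ring_mat_def by auto
  define K where "K = mat n k (\<lambda>(i,j). P $$ (i,j))"
  define S where "S = mat n (n - k) (\<lambda>(i,j). P $$ (i,j + k))"
  define L where "L = mat k n (\<lambda>(i,j). Q $$ (i,j))"
  define F where "F = mat (n - k) n (\<lambda>(i,j). Q $$ (i + k,j))"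
  note defs = K_def S_def L_def F_def
  have car: "K \<in> carrier_mat n k" "L \<in> carrier_mat k n"
    "S \<in> carrier_mat n (n - k)" "F \<in> carrier_mat (n - k) n"
    by (auto simp: defs)
  have QP: "(\<Sum>l<n. Q $$ (i,l) * P $$ (l,j)) = (if i = j then 1 else 0)" if "i < n" "j < n" for i j
    using arg_cong[OF Q(2), of "\<lambda>M. M $$ (i,j)"] that P Q(1)
    by (auto simp: scalar_prod_def lessThan_atLeast0)
  have PQ: "(\<Sum>l<n. P $$ (i,l) * Q $$ (l,j)) = (if i = j then 1 else 0)" if "i < n" "j < n" for i j
    using arg_cong[OF Q(3), of "\<lambda>M. M $$ (i,j)"] that P Q(1)
    by (auto simp: scalar_prod_def lessThan_atLeast0)
  have LK: "L * K = 1\<^sub>m k"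
    by (rule eq_matI) (use QP kn in \<open>auto simp: defs scalar_prod_def lessThan_atLeast0\<close>)
  have FS: "F * S = 1\<^sub>m (n - k)"
    by (rule eq_matI) (use QP kn in \<open>auto simp: defs scalar_prod_def lessThan_atLeast0\<close>)
  have FK: "F * K = 0\<^sub>m (n - k) k"
    by (rule eq_matI) (use QP kn in \<open>auto simp: defs scalar_prod_def lessThan_atLeast0\<close>)
  have split: "(\<Sum>l<n. f l) = (\<Sum>l<k. f l) + (\<Sum>l<n - k. f (l + k))" for f :: "nat \<Rightarrow> complex"
  proof -
    have "(\<Sum>l<n. f l) = (\<Sum>l<k. f l) + (\<Sum>l = k..<n. f l)"
      using sum.atLeastLessThan_concat[of 0 k n f] kn by (simp add: lessThan_atLeast0)
    also have "(\<Sum>l = k..<n. f l) = (\<Sum>l<n - k. f (l + k))"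
      using sum.shift_bounds_nat_ivl[of f 0 k "n - k"] kn by (simp add: lessThan_atLeast0)
    finally show ?thesis .
  qed
  have KLSF: "K * L + S * F = 1\<^sub>m n"
  proof (rule eq_matI)
    fix i j assume "i < dim_row (1\<^sub>m n)" "j < dim_col (1\<^sub>m n)"
    then show "(K * L + S * F) $$ (i, j) = 1\<^sub>m n $$ (i, j)"
      using PQ[of i j] split[of "\<lambda>l. P $$ (i,l) * Q $$ (l,j)"] kn
      by (auto simp: defs scalar_prod_def lessThan_atLeast0)
  qed (auto simp: defs)
  have colsK: "cols K = as"
  proof (rule nth_equalityI)
    show "length (cols K) = length as" by (simp add: K_def k_def)
    fix i assume "i < length (cols K)"
    then have i: "i < k" by (simp add: K_def)
    have "as ! i \<in> carrier_vec n" using i as A(2) WV nth_mem[of i as] by (auto simp: k_def)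
    then show "cols K ! i = as ! i"
      using i kn len by (auto simp: K_def P_def mat_of_cols_def k_def nth_append)
  qed
  have WK: "w \<in> W \<longleftrightarrow> (\<exists>x\<in>carrier_vec k. w = K *\<^sub>v x)" for w
    using col_space_eq[OF car(1)] car(1) spanA as colsK unfolding col_space_def
    by auto
  have WF: "W = {w \<in> carrier_vec n. F *\<^sub>v w = 0\<^sub>v (n - k)}"
  proof (intro equalityI subsetI)
    fix w assume "w \<in> W"
    then obtain x where x: "x \<in> carrier_vec k" "w = K *\<^sub>v x" using WK by auto
    have "F *\<^sub>v w = (F * K) *\<^sub>v x" using x car by (simp add: assoc_mult_mat_vec[of F "n-k" n K k x])
    also have "\<dots> = 0\<^sub>v (n - k)" using x unfolding FK by auto
    finally show "w \<in> {w \<in> carrier_vec n. F *\<^sub>v w = 0\<^sub>v (n - k)}" using x car by auto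
  next
    fix w assume "w \<in> {w \<in> carrier_vec n. F *\<^sub>v w = 0\<^sub>v (n - k)}"
    then have w: "w \<in> carrier_vec n" "F *\<^sub>v w = 0\<^sub>v (n - k)" by auto
    have "w = (K * L + S * F) *\<^sub>v w" using w KLSF by simp
    also have "\<dots> = K *\<^sub>v (L *\<^sub>v w) + S *\<^sub>v (F *\<^sub>v w)"
      using w car add_mult_distrib_mat_vec[of "K * L" n n "S * F" w]
        assoc_mult_mat_vec[of K n k L n w] assoc_mult_mat_vec[of S n "n-k" F n w] by simp
    also have "S *\<^sub>v (F *\<^sub>v w) = 0\<^sub>v n"
      unfolding w(2) using car(3) by (intro eq_vecI) (auto simp: scalar_prod_def)
    also have "K *\<^sub>v (L *\<^sub>v w) + 0\<^sub>v n = K *\<^sub>v (L *\<^sub>v w)" using w car by simp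
    finally show "w \<in> W" using WK[of w] car w by (metis mult_mat_vec_carrier)
  qed
  show thesis by (rule that[OF kn car LK FS FK KLSF WF WK])
qed


section \<open>Traces of representations as sums of irreducible characters\<close>

lemma mat_trace_comm:
  assumes "A \<in> carrier_mat n k" "B \<in> carrier_mat k n"
  shows "mat_trace (A * B) = mat_trace (B * A)"
proof -
  have "mat_trace (A * B) = (\<Sum>i<n. \<Sum>j<k. A $$ (i,j) * B $$ (j,i))"
    using assms by (auto simp: mat_trace_def scalar_prod_def lessThan_atLeast0 intro!: sum.cong)
  also have "\<dots> = (\<Sum>j<k. \<Sum>i<n. B $$ (j,i) * A $$ (i,j))"
    by (subst sum.swap) (simp add: mult.commute)
  also have "\<dots> = mat_trace (B * A)"
    using assms by (auto simp: mat_trace_def scalar_prod_def lessThan_atLeast0 intro!: sum.cong)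
  finally show ?thesis .
qed

lemma mat_trace_add:
  assumes "A \<in> carrier_mat n n" "B \<in> carrier_mat n n"
  shows "mat_trace (A + B) = mat_trace A + mat_trace B"
  using assms by (auto simp: mat_trace_def sum.distrib)

lemma mult_mat_unit_vec:
  fixes A :: "complex mat"
  assumes "A \<in> carrier_mat m k" "j < k"
  shows "A *\<^sub>v unit_vec k j = col A j"
  by (rule eq_vecI) (use assms in \<open>auto simp: scalar_prod_right_unit\<close>)

lemma mat_eq_via_vecs:
  fixes A B :: "complex mat"
  assumes "A \<in> carrier_mat m k" "B \<in> carrier_mat m k"
    and "\<And>x. x \<in> carrier_vec k \<Longrightarrow> A *\<^sub>v x = B *\<^sub>v x"
  shows "A = B"
proof (rule mat_col_eqI)
  fix j assume "j < dim_col B"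
  then have "j < k" using assms by auto
  then show "col A j = col B j"
    using assms(3)[of "unit_vec k j"] mult_mat_unit_vec[OF assms(1), of j]
      mult_mat_unit_vec[OF assms(2), of j] by simp
qed (use assms in auto)

text \<open>
  Invertibility of the representing matrices is automatic once the identity goes to the identity
  matrix; conversely an invertible idempotent, such as the image of \<open>\<one>\<close>, is the identity matrix.
\<close>

lemma (in group) matrix_rep_iff:
  "matrix_rep G n \<rho> \<longleftrightarrow>
     (\<forall>g\<in>carrier G. \<rho> g \<in> carrier_mat n n) \<and>
     (\<forall>g\<in>carrier G. \<forall>h\<in>carrier G. \<rho> (g \<otimes> h) = \<rho> g * \<rho> h) \<and> \<rho> \<one> = 1\<^sub>m n"
    (is "?l \<longleftrightarrow> ?r")
proof
  assume l: ?l
  have c: "\<rho> g \<in> Units (ring_mat TYPE(complex) n ())" if "g \<in> carrier G" for g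
    using l that by (auto simp: matrix_rep_def GL_def hom_def units_of_def)
  have c1: "\<rho> g \<in> carrier_mat n n" if "g \<in> carrier G" for g
    using c[OF that] by (auto simp: Units_def ring_mat_simps)
  have m: "\<rho> (g \<otimes> h) = \<rho> g * \<rho> h" if "g \<in> carrier G" "h \<in> carrier G" for g h
    using l that by (auto simp: matrix_rep_def GL_def hom_def units_of_def ring_mat_simps)
  obtain B where B: "B \<in> carrier_mat n n" "B * \<rho> \<one> = 1\<^sub>m n"
    using c[of \<one>] by (auto simp: Units_def ring_mat_simps)
  have "\<rho> \<one> = (B * \<rho> \<one>) * \<rho> \<one>" using B c1[of \<one>] by simp
  also have "\<dots> = B * (\<rho> \<one> * \<rho> \<one>)" using B(1) c1[of \<one>] by (simp add: mat_mult_assoc_dim)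
  also have "\<dots> = 1\<^sub>m n" using m[of \<one> \<one>] B by simp
  finally show ?r using c1 m by blast
next
  assume r: ?r
  have "\<rho> g \<in> Units (ring_mat TYPE(complex) n ())" if g: "g \<in> carrier G" for g
  proof -
    have "\<rho> g * \<rho> (inv g) = 1\<^sub>m n" "\<rho> (inv g) * \<rho> g = 1\<^sub>m n"
      using r g by (metis inv_closed r_inv, metis inv_closed l_inv)
    then show ?thesis using r g unfolding Units_def ring_mat_simps by (auto intro!: bexI[of _ "\<rho> (inv g)"])
  qed
  then show ?l using r by (auto simp: matrix_rep_def GL_def hom_def units_of_def ring_mat_simps)
qed

text \<open>
  The vanishing of \<open>F (\<rho> g K)\<close> says that the lower left block of \<open>\<rho> g\<close> is zero in the basis
  \<open>[K S]\<close>; the two representations obtained are the subrepresentation on the image of \<open>K\<close> and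
  the quotient by it.
\<close>

lemma (in group) matrix_rep_split:
  assumes rep: "matrix_rep G n \<rho>"
    and car: "K \<in> carrier_mat n k" "L \<in> carrier_mat k n"
      "S \<in> carrier_mat n m" "F \<in> carrier_mat m n"
    and LK: "L * K = 1\<^sub>m k" and FS: "F * S = 1\<^sub>m m" and id: "K * L + S * F = 1\<^sub>m n"
    and inv: "\<And>g. g \<in> carrier G \<Longrightarrow> F * (\<rho> g * K) = 0\<^sub>m m k"
  shows "matrix_rep G k (\<lambda>g. L * (\<rho> g * K))" "matrix_rep G m (\<lambda>g. F * (\<rho> g * S))"
    and "\<And>g. g \<in> carrier G \<Longrightarrow>
      mat_trace (\<rho> g) = mat_trace (L * (\<rho> g * K)) + mat_trace (F * (\<rho> g * S))"
proof -
  note dims = car[THEN carrier_matD(1)] car[THEN carrier_matD(2)]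
  have r: "\<rho> g \<in> carrier_mat n n" if "g \<in> carrier G" for g using rep that matrix_rep_iff by blast
  have mul: "\<rho> (g \<otimes> h) = \<rho> g * \<rho> h" if "g \<in> carrier G" "h \<in> carrier G" for g h
    using rep that matrix_rep_iff by blast
  have one: "\<rho> \<one> = 1\<^sub>m n" using rep matrix_rep_iff by blast
  note rd = r[THEN carrier_matD(1)] r[THEN carrier_matD(2)]
  have rK: "\<rho> g * K = K * (L * (\<rho> g * K))" if g: "g \<in> carrier G" for g
  proof -
    have "\<rho> g * K = (K * L + S * F) * (\<rho> g * K)" using id r[OF g] car by simp
    also have "\<dots> = K * L * (\<rho> g * K) + S * F * (\<rho> g * K)"
      by (rule add_mult_distrib_mat) (use r[OF g] car in auto)
    also have "S * F * (\<rho> g * K) = S * (F * (\<rho> g * K))"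
      using g dims rd by (simp add: mat_mult_assoc_dim)
    also have "\<dots> = 0\<^sub>m n k" unfolding inv[OF g] using car by simp
    also have "K * L * (\<rho> g * K) + 0\<^sub>m n k = K * L * (\<rho> g * K)"
      using r[OF g] car by (intro right_add_zero_mat) auto
    finally show ?thesis using g dims rd by (simp add: mat_mult_assoc_dim)
  qed
  have Fr: "F * \<rho> g = F * (\<rho> g * S) * F" if g: "g \<in> carrier G" for g
  proof -
    have "F * \<rho> g = (F * \<rho> g) * (K * L + S * F)" using id r[OF g] car by simp
    also have "\<dots> = F * \<rho> g * (K * L) + F * \<rho> g * (S * F)"
      by (rule mult_add_distrib_mat) (use r[OF g] car in auto)
    also have "F * \<rho> g * (K * L) = (F * (\<rho> g * K)) * L"
      using g dims rd by (simp add: mat_mult_assoc_dim)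
    also have "\<dots> = 0\<^sub>m m n" unfolding inv[OF g] using car by simp
    also have "0\<^sub>m m n + F * \<rho> g * (S * F) = F * \<rho> g * (S * F)"
      using r[OF g] car by (intro left_add_zero_mat) auto
    finally show ?thesis using g dims rd by (simp add: mat_mult_assoc_dim)
  qed
  show "matrix_rep G k (\<lambda>g. L * (\<rho> g * K))"
    unfolding matrix_rep_iff
  proof (intro conjI ballI)
    fix g h assume gh: "g \<in> carrier G" "h \<in> carrier G"
    have "L * (\<rho> (g \<otimes> h) * K) = L * (\<rho> g * (\<rho> h * K))"
      using mul[OF gh] gh dims rd by (simp add: mat_mult_assoc_dim)
    also have "\<dots> = L * (\<rho> g * (K * (L * (\<rho> h * K))))" using rK[OF gh(2)] by simp
    also have "\<dots> = L * (\<rho> g * K) * (L * (\<rho> h * K))"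
      using gh dims rd by (simp add: mat_mult_assoc_dim)
    finally show "L * (\<rho> (g \<otimes> h) * K) = L * (\<rho> g * K) * (L * (\<rho> h * K))" .
  qed (use car r one LK in auto)
  show "matrix_rep G m (\<lambda>g. F * (\<rho> g * S))"
    unfolding matrix_rep_iff
  proof (intro conjI ballI)
    fix g h assume gh: "g \<in> carrier G" "h \<in> carrier G"
    have "F * (\<rho> (g \<otimes> h) * S) = (F * \<rho> g) * (\<rho> h * S)"
      using mul[OF gh] gh dims rd by (simp add: mat_mult_assoc_dim)
    also have "\<dots> = (F * (\<rho> g * S) * F) * (\<rho> h * S)" using Fr[OF gh(1)] by simp
    also have "\<dots> = F * (\<rho> g * S) * (F * (\<rho> h * S))"
      using gh dims rd by (simp add: mat_mult_assoc_dim)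
    finally show "F * (\<rho> (g \<otimes> h) * S) = F * (\<rho> g * S) * (F * (\<rho> h * S))" .
  qed (use car r one FS in auto)
  fix g assume g: "g \<in> carrier G"
  have "\<rho> g = \<rho> g * (K * L + S * F)" using id r[OF g] by simp
  also have "\<dots> = \<rho> g * (K * L) + \<rho> g * (S * F)"
    by (rule mult_add_distrib_mat) (use r[OF g] car in auto)
  also have "\<dots> = (\<rho> g * K) * L + (\<rho> g * S) * F"
    using g dims rd by (simp add: mat_mult_assoc_dim)
  finally have "mat_trace (\<rho> g) = mat_trace ((\<rho> g * K) * L) + mat_trace ((\<rho> g * S) * F)"
    using mat_trace_add[of "\<rho> g * K * L" n "\<rho> g * S * F"] r[OF g] car by simp
  then show "mat_trace (\<rho> g) = mat_trace (L * (\<rho> g * K)) + mat_trace (F * (\<rho> g * S))"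
    using mat_trace_comm[of "\<rho> g * K" n k L] mat_trace_comm[of "\<rho> g * S" n m F] r[OF g] car by simp
qed

lemma frame_invariant:
  fixes F R K :: "complex mat"
  assumes car: "K \<in> carrier_mat n k" "F \<in> carrier_mat (n - k) n" "R \<in> carrier_mat n n"
    and W: "W = {w \<in> carrier_vec n. F *\<^sub>v w = 0\<^sub>v (n - k)}"
      "\<And>w. w \<in> W \<longleftrightarrow> (\<exists>x\<in>carrier_vec k. w = K *\<^sub>v x)"
    and inv: "\<And>w. w \<in> W \<Longrightarrow> R *\<^sub>v w \<in> W"
  shows "F * (R * K) = 0\<^sub>m (n - k) k"
proof (rule mat_eq_via_vecs[of _ "n - k" k])
  fix x :: "complex vec" assume x: "x \<in> carrier_vec k"
  then have "R *\<^sub>v (K *\<^sub>v x) \<in> W" using W(2) inv by blast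
  then have "F *\<^sub>v (R *\<^sub>v (K *\<^sub>v x)) = 0\<^sub>v (n - k)" using W(1) by blast
  then show "(F * (R * K)) *\<^sub>v x = 0\<^sub>m (n - k) k *\<^sub>v x"
    using x car assoc_mult_mat_vec[of F "n - k" n "R * K" k x] assoc_mult_mat_vec[of R n n K k x]
    by (auto intro!: eq_vecI)
qed (use car in auto)

text \<open>
  The summands are the characters of the factors of a composition series, which is built by
  splitting along a proper invariant subspace until the representation is irreducible or of
  degree 0.
\<close>

lemma (in group) character_as_sum_of_irr:
  assumes "matrix_rep G n \<rho>"
  shows "\<exists>\<psi>s. set \<psi>s \<subseteq> Irr G \<and> (\<forall>g\<in>carrier G. mat_trace (\<rho> g) = (\<Sum>\<psi>\<leftarrow>\<psi>s. \<psi> g))"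
  using assms
proof (induction n arbitrary: \<rho> rule: less_induct)
  case (less n)
  have r: "\<rho> g \<in> carrier_mat n n" if "g \<in> carrier G" for g
    using less.prems that matrix_rep_iff by blast
  consider "n = 0" | "irreducible_rep G n \<rho>" | "n > 0" "\<not> irreducible_rep G n \<rho>" by auto
  then show ?case
  proof cases
    case 1
    then have "mat_trace (\<rho> g) = 0" if "g \<in> carrier G" for g
      using r[OF that] by (simp add: mat_trace_def)
    then show ?thesis by (intro exI[of _ "[]"]) auto
  next
    case 2
    then have "character_of G \<rho> \<in> Irr G" by (auto simp: Irr_def)
    then show ?thesis by (intro exI[of _ "[character_of G \<rho>]"]) (auto simp: character_of_def)
  next
    case 3
    then obtain W where W: "VectorSpace.subspace class_ring W (module_vec TYPE(complex) n)"
      and Winv: "\<And>g w. g \<in> carrier G \<Longrightarrow> w \<in> W \<Longrightarrow> \<rho> g *\<^sub>v w \<in> W"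
      and Wne: "W \<noteq> {0\<^sub>v n}" "W \<noteq> carrier_vec n"
      using less.prems unfolding irreducible_rep_def by blast
    obtain k K L S F where kn: "k \<le> n"
      and car: "K \<in> carrier_mat n k" "L \<in> carrier_mat k n"
        "S \<in> carrier_mat n (n - k)" "F \<in> carrier_mat (n - k) n"
      and LK: "L * K = 1\<^sub>m k" and FS: "F * S = 1\<^sub>m (n - k)"
      and FK: "F * K = 0\<^sub>m (n - k) k" and id: "K * L + S * F = 1\<^sub>m n"
      and WF: "W = {w \<in> carrier_vec n. F *\<^sub>v w = 0\<^sub>v (n - k)}"
      and WK: "\<And>w. w \<in> W \<longleftrightarrow> (\<exists>x\<in>carrier_vec k. w = K *\<^sub>v x)"
      by (rule subspace_frame[OF W], rule that)
    have "k \<noteq> n"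
    proof
      assume "k = n"
      then have "W = carrier_vec n" unfolding WF using car by auto
      then show False using Wne by simp
    qed
    moreover have "k \<noteq> 0"
    proof
      assume k: "k = 0"
      have "K *\<^sub>v x = 0\<^sub>v n" if "x \<in> carrier_vec k" for x
        using that car k by (auto intro!: eq_vecI simp: scalar_prod_def)
      moreover have "0\<^sub>v k \<in> carrier_vec k" by simp
      ultimately have "w \<in> W \<longleftrightarrow> w = 0\<^sub>v n" for w unfolding WK by metis
      then have "W = {0\<^sub>v n}" by blast
      then show False using Wne by simp
    qed
    ultimately have lt: "k < n" "n - k < n" using kn by auto
    have inv: "F * (\<rho> g * K) = 0\<^sub>m (n - k) k" if g: "g \<in> carrier G" for g
      by (rule frame_invariant[OF car(1,4) r[OF g] WF WK Winv[OF g]])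
    note split = matrix_rep_split[OF less.prems car LK FS id inv]
    obtain \<psi>s \<phi>s where
      "set \<psi>s \<subseteq> Irr G" "\<forall>g\<in>carrier G. mat_trace (L * (\<rho> g * K)) = (\<Sum>\<psi>\<leftarrow>\<psi>s. \<psi> g)"
      "set \<phi>s \<subseteq> Irr G" "\<forall>g\<in>carrier G. mat_trace (F * (\<rho> g * S)) = (\<Sum>\<psi>\<leftarrow>\<phi>s. \<psi> g)"
      using less.IH[OF lt(1) split(1)] less.IH[OF lt(2) split(2)] by auto
    then show ?thesis using split(3) by (intro exI[of _ "\<psi>s @ \<phi>s"]) auto
  qed
qed

text \<open>
  The image of \<open>\<Psi>\<close> is an invariant subspace on which \<open>R\<close> is similar to \<open>\<rho>\<close>, so the first
  diagonal block contributes the trace of \<open>\<rho>\<close>.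
\<close>

lemma (in group) embedded_rep_splits:
  assumes R: "matrix_rep G N R" and rho: "matrix_rep G n \<rho>"
    and Psi: "\<Psi> \<in> carrier_mat N n"
    and inter: "\<And>g. g \<in> carrier G \<Longrightarrow> R g * \<Psi> = \<Psi> * \<rho> g"
    and inj: "\<And>x. x \<in> carrier_vec n \<Longrightarrow> \<Psi> *\<^sub>v x = 0\<^sub>v N \<Longrightarrow> x = 0\<^sub>v n"
  shows "\<exists>m \<sigma>. matrix_rep G m \<sigma> \<and>
    (\<forall>g\<in>carrier G. mat_trace (R g) = mat_trace (\<rho> g) + mat_trace (\<sigma> g))"
proof -
  have Rc: "R g \<in> carrier_mat N N" if "g \<in> carrier G" for g using R that matrix_rep_iff by blast
  have rc: "\<rho> g \<in> carrier_mat n n" if "g \<in> carrier G" for g using rho that matrix_rep_iff by blast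
  define W where "W = {\<Psi> *\<^sub>v x | x. x \<in> carrier_vec n}"
  have WI: "\<Psi> *\<^sub>v x \<in> W" if "x \<in> carrier_vec n" for x using that by (auto simp: W_def)
  have sub: "VectorSpace.subspace class_ring W (module_vec TYPE(complex) N)"
    unfolding subspace_def submodule_def
  proof (intro conjI vec_vs vec_module allI impI)
    show "W \<subseteq> carrier (module_vec TYPE(complex) N)"
      using Psi by (auto simp: W_def module_vec_simps)
    show "\<zero>\<^bsub>module_vec TYPE(complex) N\<^esub> \<in> W"
      unfolding module_vec_simps W_def using Psi
      by (intro CollectI exI[of _ "0\<^sub>v n"]) (auto intro!: eq_vecI simp: scalar_prod_def)
    fix v w assume "v \<in> W" "w \<in> W"
    then show "v \<oplus>\<^bsub>module_vec TYPE(complex) N\<^esub> w \<in> W"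
      unfolding module_vec_simps W_def
      using mult_add_distrib_mat_vec[OF Psi] add_carrier_vec by (smt (verit) mem_Collect_eq)
  next
    fix c v assume "v \<in> W"
    then obtain x where "x \<in> carrier_vec n" "v = \<Psi> *\<^sub>v x" by (auto simp: W_def)
    then show "c \<odot>\<^bsub>module_vec TYPE(complex) N\<^esub> v \<in> W"
      unfolding module_vec_simps using mult_mat_vec[OF Psi, of x c] WI[of "c \<cdot>\<^sub>v x"] by simp
  qed
  obtain k K L S F where kn: "k \<le> N"
      and car: "K \<in> carrier_mat N k" "L \<in> carrier_mat k N"
        "S \<in> carrier_mat N (N - k)" "F \<in> carrier_mat (N - k) N"
      and LK: "L * K = 1\<^sub>m k" and FS: "F * S = 1\<^sub>m (N - k)"
      and FK: "F * K = 0\<^sub>m (N - k) k" and id: "K * L + S * F = 1\<^sub>m N"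
      and WF: "W = {w \<in> carrier_vec N. F *\<^sub>v w = 0\<^sub>v (N - k)}"
      and WK: "\<And>w. w \<in> W \<longleftrightarrow> (\<exists>x\<in>carrier_vec k. w = K *\<^sub>v x)"
    by (rule subspace_frame[OF sub], rule that)
  have Winv: "R g *\<^sub>v w \<in> W" if g: "g \<in> carrier G" and w: "w \<in> W" for g w
  proof -
    obtain x where x: "x \<in> carrier_vec n" "w = \<Psi> *\<^sub>v x" using w by (auto simp: W_def)
    have "R g *\<^sub>v w = (R g * \<Psi>) *\<^sub>v x"
      using x assoc_mult_mat_vec[OF Rc[OF g] Psi] by simp
    also have "\<dots> = \<Psi> *\<^sub>v (\<rho> g *\<^sub>v x)"
      unfolding inter[OF g] using assoc_mult_mat_vec[OF Psi rc[OF g] x(1)] .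
    finally show ?thesis using WI[of "\<rho> g *\<^sub>v x"] rc[OF g] x by simp
  qed
  have inv: "F * (R g * K) = 0\<^sub>m (N - k) k" if g: "g \<in> carrier G" for g
    by (rule frame_invariant[OF car(1,4) Rc[OF g] WF WK Winv[OF g]])
  note split = matrix_rep_split[OF R car LK FS id inv]
  note dims = car[THEN carrier_matD(1)] car[THEN carrier_matD(2)]
    Psi[THEN carrier_matD(1)] Psi[THEN carrier_matD(2)]
  \<comment> \<open>The columns of \<open>\<Psi>\<close> and of \<open>K\<close> are bases of the same subspace; \<open>M\<close> and \<open>T\<close> are the matrices
    of the two base changes.\<close>
  define M where "M = L * \<Psi>"
  have M: "M \<in> carrier_mat k n" using car Psi by (simp add: M_def)
  have KM: "\<Psi> = K * M"
  proof (rule mat_eq_via_vecs[OF Psi])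
    fix x :: "complex vec" assume x: "x \<in> carrier_vec n"
    then obtain y where y: "y \<in> carrier_vec k" "\<Psi> *\<^sub>v x = K *\<^sub>v y" using WI WK by metis
    have "L *\<^sub>v (\<Psi> *\<^sub>v x) = y"
      unfolding y(2) using assoc_mult_mat_vec[OF car(2,1) y(1)] LK y(1) by simp
    then have "(K * M) *\<^sub>v x = K *\<^sub>v y"
      using assoc_mult_mat_vec[OF car(1) M x] assoc_mult_mat_vec[OF car(2) Psi x] by (simp add: M_def)
    then show "\<Psi> *\<^sub>v x = (K * M) *\<^sub>v x" using y by simp
  qed (use car M in auto)
  have "\<forall>j. \<exists>x. j < k \<longrightarrow> x \<in> carrier_vec n \<and> col K j = \<Psi> *\<^sub>v x"
  proof
    fix j
    have "K *\<^sub>v unit_vec k j \<in> W" unfolding WK by (intro bexI[of _ "unit_vec k j"]) auto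
    then obtain x where "x \<in> carrier_vec n" "K *\<^sub>v unit_vec k j = \<Psi> *\<^sub>v x"
      by (auto simp: W_def)
    then show "\<exists>x. j < k \<longrightarrow> x \<in> carrier_vec n \<and> col K j = \<Psi> *\<^sub>v x"
      using mult_mat_unit_vec[OF car(1), of j] by auto
  qed
  then obtain t where t: "\<And>j. j < k \<Longrightarrow> t j \<in> carrier_vec n \<and> col K j = \<Psi> *\<^sub>v t j" by metis
  define T where "T = mat n k (\<lambda>(i,j). t j $ i)"
  have T: "T \<in> carrier_mat n k" by (simp add: T_def)
  have PT: "\<Psi> * T = K"
  proof (rule mat_col_eqI)
    fix j assume "j < dim_col K"
    then have j: "j < k" using car by simp
    have "col T j = t j" using t[OF j] j by (auto simp: T_def)
    then show "col (\<Psi> * T) j = col K j" using col_mult2[OF Psi T j] t[OF j] by simp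
  qed (use Psi T car in auto)
  have TM: "T * M = 1\<^sub>m n"
  proof (rule mat_eq_via_vecs[of _ n n])
    fix x :: "complex vec" assume x: "x \<in> carrier_vec n"
    let ?y = "(T * M) *\<^sub>v x"
    have y: "?y \<in> carrier_vec n" using T M x by auto
    have "\<Psi> *\<^sub>v ?y = (\<Psi> * (T * M)) *\<^sub>v x"
      using assoc_mult_mat_vec[OF Psi _ x, of "T * M"] T M by simp
    also have "\<Psi> * (T * M) = \<Psi>"
      using assoc_mult_mat[OF Psi T M] PT KM by simp
    finally have "\<Psi> *\<^sub>v (?y - x) = 0\<^sub>v N"
      using mult_minus_distrib_mat_vec[OF Psi y x] Psi x by simp
    then have diff: "?y - x = 0\<^sub>v n" using inj[of "?y - x"] x y by simp
    have "?y = x"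
    proof (rule eq_vecI)
      fix i assume "i < dim_vec x"
      then show "?y $ i = x $ i"
        using arg_cong[OF diff, of "\<lambda>v. v $ i"] x y by simp
    qed (use x T in auto)
    then show "?y = 1\<^sub>m n *\<^sub>v x" using x by simp
  qed (use T M in auto)
  have tr: "mat_trace (L * (R g * K)) = mat_trace (\<rho> g)" if g: "g \<in> carrier G" for g
  proof -
    have "L * (R g * K) = L * (R g * \<Psi> * T)"
      using PT assoc_mult_mat[OF Rc[OF g] Psi T] by simp
    also have "\<dots> = M * \<rho> g * T"
      unfolding inter[OF g] M_def using dims T rc[OF g] by (simp add: mat_mult_assoc_dim)
    also have "mat_trace \<dots> = mat_trace (T * (M * \<rho> g))"
      by (rule mat_trace_comm[of _ k n]) (use M T rc[OF g] in auto)
    also have "T * (M * \<rho> g) = \<rho> g"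
      using assoc_mult_mat[OF T M rc[OF g]] TM rc[OF g] by simp
    finally show ?thesis .
  qed
  show ?thesis using split(2,3) tr by (intro exI[of _ "N - k"] exI[of _ "\<lambda>g. F * (R g * S)"]) auto
qed


section \<open>The regular representation\<close>

text \<open>The list \<open>xs\<close> enumerates the group and thereby orders the basis of the group algebra.\<close>

definition (in group) regular_rep :: "'a list \<Rightarrow> 'a \<Rightarrow> complex mat" where
  "regular_rep xs g = mat (length xs) (length xs) (\<lambda>(i,j). if xs ! i = g \<otimes> xs ! j then 1 else 0)"

text \<open>
  In row \<open>i\<close> of the permutation matrix \<open>regular_rep xs g\<close> the only 1 stands in the column that
  belongs to the group element \<open>inv g \<otimes> xs ! i\<close>.
\<close>

lemma (in group) regular_rep_mult_index:
  assumes xs: "distinct xs" "set xs = carrier G" and g: "g \<in> carrier G"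
    and A: "A \<in> carrier_mat (length xs) m" and i: "i < length xs" and j: "j < m"
    and l: "l < length xs" "xs ! l = inv g \<otimes> xs ! i"
  shows "(regular_rep xs g * A) $$ (i, j) = A $$ (l, j)"
proof -
  have xc: "xs ! i' \<in> carrier G" if "i' < length xs" for i' using that xs(2) nth_mem by blast
  have eq: "xs ! i = g \<otimes> xs ! t \<longleftrightarrow> t = l" if t: "t < length xs" for t
  proof -
    have "xs ! i = g \<otimes> xs ! t \<longleftrightarrow> xs ! t = inv g \<otimes> xs ! i"
      using g xc[OF i] xc[OF t] by (metis inv_solve_left)
    also have "\<dots> \<longleftrightarrow> t = l" using l t xs(1) by (simp add: nth_eq_iff_index_eq flip: l(2))
    finally show ?thesis .
  qed
  have "(regular_rep xs g * A) $$ (i, j) =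
      (\<Sum>t<length xs. (if xs ! i = g \<otimes> xs ! t then 1 else 0) * A $$ (t, j))"
    using A i j by (simp add: regular_rep_def scalar_prod_def lessThan_atLeast0)
  also have "\<dots> = (\<Sum>t<length xs. if t = l then A $$ (t, j) else 0)"
    by (rule sum.cong) (auto simp: eq)
  also have "\<dots> = A $$ (l, j)" using l by simp
  finally show ?thesis .
qed

lemma (in group) matrix_rep_regular:
  assumes xs: "distinct xs" "set xs = carrier G"
  shows "matrix_rep G (length xs) (regular_rep xs)"
  unfolding matrix_rep_iff
proof (intro conjI ballI)
  have xc: "xs ! i \<in> carrier G" if "i < length xs" for i using that xs(2) nth_mem by blast
  show "regular_rep xs g \<in> carrier_mat (length xs) (length xs)" for g
    by (simp add: regular_rep_def)
  show "regular_rep xs \<one> = 1\<^sub>m (length xs)"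
    by (rule eq_matI) (use xs(1) xc in \<open>auto simp: regular_rep_def nth_eq_iff_index_eq\<close>)
  fix g h assume gh: "g \<in> carrier G" "h \<in> carrier G"
  show "regular_rep xs (g \<otimes> h) = regular_rep xs g * regular_rep xs h"
  proof (rule eq_matI)
    fix i j assume "i < dim_row (regular_rep xs g * regular_rep xs h)"
      "j < dim_col (regular_rep xs g * regular_rep xs h)"
    then have i: "i < length xs" and j: "j < length xs" by (auto simp: regular_rep_def)
    have "inv g \<otimes> xs ! i \<in> set xs" using xs(2) gh xc[OF i] by simp
    then obtain l where l: "l < length xs" "xs ! l = inv g \<otimes> xs ! i"
      by (auto simp: in_set_conv_nth)
    have "xs ! l = h \<otimes> xs ! j \<longleftrightarrow> xs ! i = g \<otimes> (h \<otimes> xs ! j)"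
      unfolding l(2) using gh xc[OF i] xc[OF j] by (metis inv_solve_left m_closed)
    then show "regular_rep xs (g \<otimes> h) $$ (i, j) = (regular_rep xs g * regular_rep xs h) $$ (i, j)"
      using regular_rep_mult_index[OF xs gh(1) _ i j l, of "regular_rep xs h"] i j l gh xc[OF j]
      by (simp add: regular_rep_def m_assoc)
  qed (auto simp: regular_rep_def)
qed

text \<open>The trace counts the fixed points of left multiplication by \<open>g\<close>.\<close>

lemma (in group) trace_regular_rep:
  assumes xs: "set xs = carrier G" and g: "g \<in> carrier G"
  shows "mat_trace (regular_rep xs g) = (if g = \<one> then of_nat (length xs) else 0)"
proof -
  have "xs ! i = g \<otimes> xs ! i \<longleftrightarrow> g = \<one>" if "i < length xs" for i
  proof -
    have "xs ! i \<in> carrier G" using nth_mem[OF that] xs by simp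
    then show ?thesis using g by simp
  qed
  then show ?thesis by (simp add: mat_trace_def regular_rep_def)
qed

text \<open>
  A vector \<open>v\<close> is sent to the function \<open>x \<mapsto> (\<rho> (inv x) v) $ 0\<close> on the group. This map intertwines
  \<open>\<rho>\<close> with the regular representation, and its kernel is an invariant subspace. The kernel
  misses the first unit vector, as one sees at \<open>x = \<one>\<close>, so it is trivial by irreducibility.
\<close>

lemma (in group) irreducible_in_regular:
  assumes xs: "distinct xs" "set xs = carrier G" and irr: "irreducible_rep G n \<rho>"
  shows "\<exists>m \<sigma>. matrix_rep G m \<sigma> \<and>
    (\<forall>g\<in>carrier G. mat_trace (regular_rep xs g) = mat_trace (\<rho> g) + mat_trace (\<sigma> g))"
proof -
  let ?N = "length xs"
  have rep: "matrix_rep G n \<rho>" and n: "n > 0"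
    and irrW: "\<And>W. VectorSpace.subspace class_ring W (module_vec TYPE(complex) n) \<Longrightarrow>
      (\<And>g w. g \<in> carrier G \<Longrightarrow> w \<in> W \<Longrightarrow> \<rho> g *\<^sub>v w \<in> W) \<Longrightarrow> W = {0\<^sub>v n} \<or> W = carrier_vec n"
    using irr by (auto simp: irreducible_rep_def)
  have r: "\<rho> g \<in> carrier_mat n n" if "g \<in> carrier G" for g using rep that matrix_rep_iff by blast
  have mul: "\<rho> (g \<otimes> h) = \<rho> g * \<rho> h" if "g \<in> carrier G" "h \<in> carrier G" for g h
    using rep that matrix_rep_iff by blast
  have one: "\<rho> \<one> = 1\<^sub>m n" using rep matrix_rep_iff by blast
  have xc: "xs ! i \<in> carrier G" if "i < ?N" for i using that xs(2) nth_mem by blast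
  define \<Psi> where "\<Psi> = mat ?N n (\<lambda>(i,j). \<rho> (inv (xs ! i)) $$ (0, j))"
  have Psi: "\<Psi> \<in> carrier_mat ?N n" by (simp add: \<Psi>_def)
  have Psi_index: "(\<Psi> *\<^sub>v v) $ i = (\<rho> (inv (xs ! i)) *\<^sub>v v) $ 0"
    if "i < ?N" "v \<in> carrier_vec n" for i v
    using that n r[of "inv (xs ! i)"] xc[of i] by (simp add: \<Psi>_def scalar_prod_def)
  have inter: "regular_rep xs g * \<Psi> = \<Psi> * \<rho> g" if g: "g \<in> carrier G" for g
  proof (rule eq_matI)
    fix i j assume "i < dim_row (\<Psi> * \<rho> g)" "j < dim_col (\<Psi> * \<rho> g)"
    then have i: "i < ?N" and j: "j < n" using Psi r[OF g] by auto
    have "inv g \<otimes> xs ! i \<in> set xs" using xs(2) g xc[OF i] by simp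
    then obtain l where l: "l < ?N" "xs ! l = inv g \<otimes> xs ! i" by (auto simp: in_set_conv_nth)
    have "inv (xs ! l) = inv (xs ! i) \<otimes> g"
      unfolding l(2) using g xc[OF i] by (simp add: inv_mult_group)
    then have "(regular_rep xs g * \<Psi>) $$ (i, j) = (\<rho> (inv (xs ! i)) * \<rho> g) $$ (0, j)"
      using regular_rep_mult_index[OF xs g Psi i j l] l(1) j mul[of "inv (xs ! i)" g] g xc[OF i]
      by (simp add: \<Psi>_def)
    also have "\<dots> = (\<Psi> * \<rho> g) $$ (i, j)"
      using i j n r[OF g] r[of "inv (xs ! i)"] xc[OF i] by (simp add: \<Psi>_def scalar_prod_def)
    finally show "(regular_rep xs g * \<Psi>) $$ (i, j) = (\<Psi> * \<rho> g) $$ (i, j)" .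
  qed (use Psi r[OF g] in \<open>auto simp: regular_rep_def\<close>)
  define W where "W = {v \<in> carrier_vec n. \<Psi> *\<^sub>v v = 0\<^sub>v ?N}"
  have sub: "VectorSpace.subspace class_ring W (module_vec TYPE(complex) n)"
    unfolding subspace_def submodule_def
  proof (intro conjI vec_vs vec_module allI impI)
    show "W \<subseteq> carrier (module_vec TYPE(complex) n)" by (auto simp: W_def module_vec_simps)
    show "\<zero>\<^bsub>module_vec TYPE(complex) n\<^esub> \<in> W"
      unfolding module_vec_simps W_def using Psi by (auto simp: scalar_prod_def)
    show "v \<oplus>\<^bsub>module_vec TYPE(complex) n\<^esub> w \<in> W" if "v \<in> W" "w \<in> W" for v w
      using that mult_add_distrib_mat_vec[OF Psi, of v w] by (simp add: W_def module_vec_simps)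
    show "c \<odot>\<^bsub>module_vec TYPE(complex) n\<^esub> v \<in> W" if "v \<in> W" for c v
      using that mult_mat_vec[OF Psi, of v c]
      by (auto simp: W_def module_vec_simps)
  qed
  have "\<rho> g *\<^sub>v w \<in> W" if g: "g \<in> carrier G" and w: "w \<in> W" for g w
  proof -
    have wc: "w \<in> carrier_vec n" and w0: "\<Psi> *\<^sub>v w = 0\<^sub>v ?N" using w by (auto simp: W_def)
    have Rg: "regular_rep xs g \<in> carrier_mat ?N ?N" by (simp add: regular_rep_def)
    have "\<Psi> *\<^sub>v (\<rho> g *\<^sub>v w) = regular_rep xs g *\<^sub>v (\<Psi> *\<^sub>v w)"
      using assoc_mult_mat_vec[OF Psi r[OF g] wc] assoc_mult_mat_vec[OF Rg Psi wc] inter[OF g] by simp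
    also have "\<dots> = 0\<^sub>v ?N" unfolding w0 using Rg by (auto simp: scalar_prod_def)
    finally show ?thesis using r[OF g] wc by (simp add: W_def)
  qed
  then have "W = {0\<^sub>v n} \<or> W = carrier_vec n" by (rule irrW[OF sub])
  moreover have "W \<noteq> carrier_vec n"
  proof
    assume "W = carrier_vec n"
    then have "unit_vec n 0 \<in> W" by simp
    then have z: "\<Psi> *\<^sub>v unit_vec n 0 = 0\<^sub>v ?N" unfolding W_def by blast
    obtain i where i: "i < ?N" "xs ! i = \<one>" using xs(2) by (metis in_set_conv_nth one_closed)
    have "(\<Psi> *\<^sub>v unit_vec n 0) $ i = 1" using Psi_index[OF i(1)] i one n by simp
    then show False using z i by simp
  qed
  ultimately have W0: "W = {0\<^sub>v n}" by blast
  show ?thesis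
    by (rule embedded_rep_splits[OF matrix_rep_regular[OF xs] rep Psi inter])
       (use W0 in \<open>unfold W_def, blast+\<close>)
qed

lemma (in group) irr_constituent_of_regular:
  assumes xs: "distinct xs" "set xs = carrier G" and chi: "\<chi> \<in> Irr G"
  obtains \<psi>s where "set \<psi>s \<subseteq> Irr G" "\<chi> \<in> set \<psi>s"
    "\<And>g. g \<in> carrier G \<Longrightarrow> (\<Sum>\<psi>\<leftarrow>\<psi>s. \<psi> g) = (if g = \<one> then of_nat (length xs) else 0)"
proof -
  obtain n \<rho> where irr: "irreducible_rep G n \<rho>" and chi_def: "\<chi> = character_of G \<rho>"
    using chi by (auto simp: Irr_def)
  obtain m \<sigma> where s: "matrix_rep G m \<sigma>"
    and tr: "\<forall>g\<in>carrier G. mat_trace (regular_rep xs g) = mat_trace (\<rho> g) + mat_trace (\<sigma> g)"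
    using irreducible_in_regular[OF xs irr] by blast
  obtain \<phi>s where phis: "set \<phi>s \<subseteq> Irr G" "\<forall>g\<in>carrier G. mat_trace (\<sigma> g) = (\<Sum>\<psi>\<leftarrow>\<phi>s. \<psi> g)"
    using character_as_sum_of_irr[OF s] by blast
  show thesis
  proof (rule that[of "\<chi> # \<phi>s"])
    fix g assume "g \<in> carrier G"
    then show "(\<Sum>\<psi>\<leftarrow>\<chi> # \<phi>s. \<psi> g) = (if g = \<one> then of_nat (length xs) else 0)"
      using tr phis(2) trace_regular_rep[OF xs(2), of g] by (simp add: chi_def character_of_def)
  qed (use chi phis(1) in auto)
qed

lemma (in group) only_identity_conjugate_to_identity:
  assumes "a \<in> carrier G"
  shows "conjugate_in G a \<one> \<longleftrightarrow> a = \<one>" "conjugate_in G \<one> a \<longleftrightarrow> a = \<one>"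
proof -
  have to: "a = \<one>" if g: "g \<in> carrier G" "\<one> = g \<otimes> a \<otimes> inv g" for g
  proof -
    have "g \<otimes> a = g" using g assms by (metis inv_equality inv_inv inv_closed m_closed)
    then show ?thesis using g assms by simp
  qed
  have fro: "a = \<one>" if g: "g \<in> carrier G" "a = g \<otimes> \<one> \<otimes> inv g" for g
    using g by simp
  have self: "conjugate_in G \<one> \<one>"
    unfolding conjugate_in_def by (rule bexI[of _ \<one>]) simp_all
  show "conjugate_in G a \<one> \<longleftrightarrow> a = \<one>"
    using to self unfolding conjugate_in_def by metis
  show "conjugate_in G \<one> a \<longleftrightarrow> a = \<one>"
    using fro self unfolding conjugate_in_def by metis
qed

section \<open>Columns differing in one entry\<close>

theorem mainTheorem6:
  fixes G :: "('a, 'b) monoid_scheme"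
  assumes "group G"
    and "finite (carrier G)"
    and "Coset.order G > 2"
  shows "CD1_group G \<longleftrightarrow>
    (\<exists>\<chi>\<in>Irr G. carrier G \<inter> (\<Inter>\<psi>\<in>Irr G - {\<chi>}. char_kernel G \<psi>) \<noteq> {\<one>\<^bsub>G\<^esub>})"
proof -
  interpret group G by fact
  obtain xs where xs: "distinct xs" "set xs = carrier G"
    using finite_distinct_list[OF assms(2)] by blast
  have N: "length xs \<noteq> 0" using xs(2) one_closed by force
  let ?K = "\<lambda>\<chi>. carrier G \<inter> (\<Inter>\<psi>\<in>Irr G - {\<chi>}. char_kernel G \<psi>)"
  have memK: "x \<in> ?K \<chi> \<longleftrightarrow> x \<in> carrier G \<and> (\<forall>\<psi>\<in>Irr G - {\<chi>}. \<psi> x = \<psi> \<one>\<^bsub>G\<^esub>)" for x \<chi>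
    by (auto simp: char_kernel_def)
  show ?thesis
  proof
    assume "CD1_group G"
    then obtain a b \<chi> where ab: "a \<in> carrier G" "b \<in> carrier G" "\<not> conjugate_in G a b"
      and chi: "\<chi> \<in> Irr G" "\<chi> a \<noteq> \<chi> b" and eq: "\<And>\<psi>. \<psi> \<in> Irr G - {\<chi>} \<Longrightarrow> \<psi> a = \<psi> b"
      unfolding CD1_group_def by blast
    obtain \<psi>s where psis: "set \<psi>s \<subseteq> Irr G" "\<chi> \<in> set \<psi>s"
      and reg: "\<And>g. g \<in> carrier G \<Longrightarrow>
        (\<Sum>\<psi>\<leftarrow>\<psi>s. \<psi> g) = (if g = \<one>\<^bsub>G\<^esub> then of_nat (length xs) else 0)"
      by (rule irr_constituent_of_regular[OF xs chi(1)], rule that)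
    have "(\<Sum>\<psi>\<leftarrow>\<psi>s. \<psi> a) - (\<Sum>\<psi>\<leftarrow>\<psi>s. \<psi> b) = of_nat (count_list \<psi>s \<chi>) * (\<chi> a - \<chi> b)"
      using psis(1)
    proof (induction \<psi>s)
      case (Cons \<psi> \<psi>s)
      have "\<psi> a = \<psi> b" if "\<psi> \<noteq> \<chi>" using eq[of \<psi>] Cons.prems that by simp
      then show ?case using Cons by (cases "\<psi> = \<chi>") (simp_all add: algebra_simps)
    qed simp
    moreover have "count_list \<psi>s \<chi> \<noteq> 0" using psis(2) by (simp add: count_list_0_iff)
    ultimately have "(\<Sum>\<psi>\<leftarrow>\<psi>s. \<psi> a) \<noteq> (\<Sum>\<psi>\<leftarrow>\<psi>s. \<psi> b)" using chi(2) by auto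
    then have "a = \<one>\<^bsub>G\<^esub> \<or> b = \<one>\<^bsub>G\<^esub>" using reg ab by (auto split: if_splits)
    then obtain x where "x \<in> carrier G" "x \<noteq> \<one>\<^bsub>G\<^esub>" "\<forall>\<psi>\<in>Irr G - {\<chi>}. \<psi> x = \<psi> \<one>\<^bsub>G\<^esub>"
      using ab eq only_identity_conjugate_to_identity by metis
    then have "x \<in> ?K \<chi>" "x \<noteq> \<one>\<^bsub>G\<^esub>" unfolding memK by blast+
    then have "?K \<chi> \<noteq> {\<one>\<^bsub>G\<^esub>}" by blast
    then show "\<exists>\<chi>\<in>Irr G. ?K \<chi> \<noteq> {\<one>\<^bsub>G\<^esub>}" using chi(1) by blast
  next
    assume "\<exists>\<chi>\<in>Irr G. ?K \<chi> \<noteq> {\<one>\<^bsub>G\<^esub>}"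
    then obtain \<chi> where chi: "\<chi> \<in> Irr G" "?K \<chi> \<noteq> {\<one>\<^bsub>G\<^esub>}" by blast
    have "\<one>\<^bsub>G\<^esub> \<in> ?K \<chi>" unfolding memK by simp
    then obtain x where xK: "x \<in> ?K \<chi>" and x1: "x \<noteq> \<one>\<^bsub>G\<^esub>" using chi(2) by blast
    then have x: "x \<in> carrier G" and eq: "\<And>\<psi>. \<psi> \<in> Irr G - {\<chi>} \<Longrightarrow> \<psi> x = \<psi> \<one>\<^bsub>G\<^esub>"
      unfolding memK by blast+
    obtain \<psi>s where psis: "set \<psi>s \<subseteq> Irr G"
      and reg: "\<And>g. g \<in> carrier G \<Longrightarrow>
        (\<Sum>\<psi>\<leftarrow>\<psi>s. \<psi> g) = (if g = \<one>\<^bsub>G\<^esub> then of_nat (length xs) else 0)"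
      by (rule irr_constituent_of_regular[OF xs chi(1)], rule that)
    have "\<chi> x \<noteq> \<chi> \<one>\<^bsub>G\<^esub>"
    proof
      assume "\<chi> x = \<chi> \<one>\<^bsub>G\<^esub>"
      then have "\<psi> x = \<psi> \<one>\<^bsub>G\<^esub>" if "\<psi> \<in> set \<psi>s" for \<psi> using eq psis that by blast
      then have "(\<Sum>\<psi>\<leftarrow>\<psi>s. \<psi> x) = (\<Sum>\<psi>\<leftarrow>\<psi>s. \<psi> \<one>\<^bsub>G\<^esub>)"
        by (intro arg_cong[of _ _ sum_list] map_cong) auto
      then show False using reg x x1 N by simp
    qed
    then show "CD1_group G"
      unfolding CD1_group_def
      using assms x x1 chi(1) eq only_identity_conjugate_to_identity(1)[OF x] one_closed by blast
  qed
qed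

end
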